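(* Let $G$ be a finite abelian group of type $(n_1,\dots,n_r)$ and order $n=n_1\cdots n_r$, let $m$ be a positive integer with $m\leq n$, and let $h\geq 2$ be an integer. Then $$\rho_{\pm}(G,m,h)\leq \min\{f_d(m,h) \; : \; d\in D(G,m)\},$$ where $$D(G,m)=\{d\in D(n) \; : \; d=d_1\cdots d_r \text{ for some } d_1\in D(n_1),\dots,d_r\in D(n_r) \text{ with } dn_r\geq d_rm\}.$$
   Context: A finite abelian group $G$ (written additively) has type $(n_1,\dots,n_r)$, $r\ge1$, if $G\cong\mathbb{Z}_{n_1}\times\cdots\times\mathbb{Z}_{n_r}$, where $n_1\geq 2$ and $n_i$ divides $n_{i+1}$ for each $i\in\{1,\dots,r-1\}$. For an $m$-subset $A=\{a_1,\dots,a_m\}$ of $G$ (with $m\ge 1$), the $h$-fold signed sumset is $$h_{\pm}A=\Big\{ \sum_{i=1}^m \lambda_i a_i : (\lambda_1,\dots,\lambda_m)\in\mathbb{Z}^m,\ \sum_{i=1}^m|\lambda_i|=h\Big\},$$ and $\rho_{\pm}(G,m,h)=\min\{|h_{\pm}A| : A\subseteq G,\ |A|=m\}$. For a positive integer $k$, $D(k)$ is the set of positive divisors of $k$. For positive integers $d,m,h$, $$f_d(m,h)=\left(h\lceil m/d\rceil-h+1\right)\cdot d.$$ *)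

theory Defs
  imports Complex_Main "HOL-Algebra.Elementary_Groups" "HOL-Algebra.Product_Groups"
    "HOL-Algebra.FiniteProduct"
begin

text \<open>
  Groups are structures in the sense of HOL-Algebra and hence written multiplicatively: the
  integer multiple \<open>\<lambda> a\<close> of the additive notation is \<open>a [^] \<lambda>\<close>, and the sum over
  \<open>a \<in> A\<close> is \<^term>\<open>finprod\<close>.
\<close>

definition has_type :: "('a, 'b) monoid_scheme \<Rightarrow> nat \<Rightarrow> (nat \<Rightarrow> nat) \<Rightarrow> bool" where
  "has_type G r ns \<longleftrightarrow>
     r \<ge> 1 \<and> ns 1 \<ge> 2 \<and> (\<forall>i\<in>{1..<r}. ns i dvd ns (i + 1)) \<and>
     G \<cong> product_group {1..r} (\<lambda>i. integer_mod_group (ns i))"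

text \<open>
  Coefficients are indexed by the elements of \<open>A\<close> themselves instead of by an enumeration
  \<open>a\<^sub>1, \<dots>, a\<^sub>m\<close> of them; values outside \<open>A\<close> play no role.
\<close>

definition signed_sumset :: "('a, 'b) monoid_scheme \<Rightarrow> nat \<Rightarrow> 'a set \<Rightarrow> 'a set" where
  "signed_sumset G h A =
     {finprod G (\<lambda>a. a [^]\<^bsub>G\<^esub> l a) A | l :: 'a \<Rightarrow> int. (\<Sum>a\<in>A. \<bar>l a\<bar>) = int h}"

text \<open>
  The minimum is over a nonempty finite set when \<open>G\<close> is finite and \<open>m \<le> order G\<close>.
\<close>

definition rho_pm :: "('a, 'b) monoid_scheme \<Rightarrow> nat \<Rightarrow> nat \<Rightarrow> nat" where
  "rho_pm G m h =
     Min {card (signed_sumset G h A) | A. A \<subseteq> carrier G \<and> card A = m}"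

definition pos_divisors :: "nat \<Rightarrow> nat set" where
  "pos_divisors k = {d. d > 0 \<and> d dvd k}"

definition f_bound :: "nat \<Rightarrow> nat \<Rightarrow> nat \<Rightarrow> int" where
  "f_bound d m h = (int h * \<lceil>real m / real d\<rceil> - int h + 1) * int d"

text \<open>
  The set \<open>D(G, m)\<close>; the type \<open>(n\<^sub>1, \<dots>, n\<^sub>r)\<close> of \<open>G\<close> is passed explicitly as \<open>r\<close> and \<open>ns\<close>.
\<close>

definition type_divisors ::
  "('a, 'b) monoid_scheme \<Rightarrow> nat \<Rightarrow> (nat \<Rightarrow> nat) \<Rightarrow> nat \<Rightarrow> nat set" where
  "type_divisors G r ns m =
     {d \<in> pos_divisors (order G).
        \<exists>ds :: nat \<Rightarrow> nat. (\<forall>i\<in>{1..r}. ds i \<in> pos_divisors (ns i)) \<and>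
          d = (\<Prod>i=1..r. ds i) \<and> d * ns r \<ge> ds r * m}"

end

theory Submission
  imports Defs
begin

text \<open>
  Let \<open>K = H\<^sub>1 \<times> \<dots> \<times> H\<^sub>r\<close> with \<open>H\<^sub>i\<close> the subgroup of order \<open>d\<^sub>i\<close> of \<open>\<int>\<^bsub>n\<^sub>i\<^esub>\<close>, and let \<open>x\<close> be the
  generator of the last factor, which has order \<open>N = n\<^sub>r / d\<^sub>r\<close> modulo \<open>K\<close>. The condition
  \<open>d n\<^sub>r \<ge> d\<^sub>r m\<close> says that \<open>c = \<lceil>m/d\<rceil>\<close> is at most \<open>N\<close>. If \<open>2(c - 1) < N\<close>, the \<open>c\<close> cosets
  \<open>jx + K\<close> with \<open>j = -(c-1), -(c-1)+2, \<dots>, c-1\<close> are distinct, and for a set \<open>A\<close> inside their union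
  the signed sums lie in the cosets \<open>jx + K\<close> with \<open>\<bar>j\<bar> \<le> h(c-1)\<close> and \<open>j \<equiv> h(c-1)\<close> modulo \<open>2\<close>. Step
  \<open>2\<close> makes the progression symmetric whatever the parities of \<open>c\<close> and \<open>N\<close>. If \<open>2(c - 1) \<ge> N\<close>, then
  \<open>h(c-1) + 1 > N\<close> since \<open>h \<ge> 2\<close>, and any \<open>A\<close> inside the subgroup generated by \<open>x\<close> and \<open>K\<close> will do.
\<close>

section \<open>Cosets of a subgroup along the powers of one element, and signed sums in their
  union\<close>

definition coset_union :: "('a, 'b) monoid_scheme \<Rightarrow> 'a \<Rightarrow> 'a set \<Rightarrow> int set \<Rightarrow> 'a set" where
  "coset_union G x K T = (\<lambda>(j, k). x [^]\<^bsub>G\<^esub> j \<otimes>\<^bsub>G\<^esub> k) ` (T \<times> K)"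

lemma card_coset_union_le:
  assumes "finite T" "finite K"
  shows "card (coset_union G x K T) \<le> card T * card K"
  unfolding coset_union_def using card_image_le[of "T \<times> K"] assms
  by (simp add: card_cartesian_product)

lemma finite_coset_union: "finite T \<Longrightarrow> finite K \<Longrightarrow> finite (coset_union G x K T)"
  by (simp add: coset_union_def)

context comm_group
begin

lemma coset_union_subset_carrier:
  assumes "subgroup K G" "x \<in> carrier G"
  shows "coset_union G x K T \<subseteq> carrier G"
  using assms subgroup.mem_carrier by (fastforce simp: coset_union_def)

text \<open>A coincidence \<open>x^i k = x^j l\<close> puts \<open>x^(i - j) = l k^(-1)\<close> into
  \<open>K\<close>. So \<open>dist\<close> says that distinct exponents in \<open>T\<close> give
  distinct, hence disjoint, cosets.\<close>

lemma card_coset_union: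
  assumes K: "subgroup K G" and x: "x \<in> carrier G"
    and dist: "\<And>i j. i \<in> T \<Longrightarrow> j \<in> T \<Longrightarrow> x [^] (i - j) \<in> K \<Longrightarrow> i = j"
  shows "card (coset_union G x K T) = card T * card K"
proof -
  interpret K: subgroup K G by fact
  have "inj_on (\<lambda>(j, k). x [^] j \<otimes> k) (T \<times> K)"
  proof (rule inj_onI, clarify)
    fix i k j l
    assume ij: "i \<in> T" "j \<in> T" and kl: "k \<in> K" "l \<in> K" and eq: "x [^] i \<otimes> k = x [^] j \<otimes> l"
    have "x [^] (i - j) \<otimes> k = inv (x [^] j) \<otimes> (x [^] i \<otimes> k)"
      using kl x by (simp add: int_pow_diff m_ac K.mem_carrier)
    also have "\<dots> = l"
      using kl x by (simp add: eq K.mem_carrier flip: m_assoc)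
    finally have "x [^] (i - j) = l \<otimes> inv k"
      using kl x by (metis K.mem_carrier int_pow_closed inv_solve_right)
    then have "i = j"
      using kl ij by (intro dist) auto
    with eq kl x show "i = j \<and> k = l"
      by (auto simp: K.mem_carrier)
  qed
  then show ?thesis
    by (simp add: coset_union_def card_image card_cartesian_product)
qed

text \<open>Divide the exponent by \<open>N\<close> with remainder: the power of \<open>x^N\<close>
  is absorbed into \<open>K\<close>. The left side is the subgroup generated by \<open>x\<close> and
  \<open>K\<close>.\<close>

lemma coset_union_UNIV:
  assumes K: "subgroup K G" and x: "x \<in> carrier G" and N: "N > 0" "x [^] N \<in> K"
  shows "coset_union G x K UNIV = coset_union G x K {0..<N}"
proof -
  interpret K: subgroup K G by fact
  have "x [^] j \<otimes> k \<in> coset_union G x K {0..<N}" if k: "k \<in> K" for j :: int and k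
  proof -
    have "(x [^] N) [^] (j div N) \<in> K"
      using subgroup_int_pow_closed[OF K N(2)] .
    then have "x [^] (N * (j div N)) \<otimes> k \<in> K"
      using k x by (simp add: int_pow_pow)
    moreover have "x [^] j \<otimes> k = x [^] (j mod N) \<otimes> (x [^] (N * (j div N)) \<otimes> k)"
      using x k by (simp add: K.mem_carrier int_pow_mult flip: m_assoc)
        (simp flip: int_pow_mult)
    moreover have "j mod N \<in> {0..<N}"
      using N by simp
    ultimately show ?thesis
      unfolding coset_union_def by (intro image_eqI[where x = "(j mod N, x [^] (N * (j div N)) \<otimes> k)"]) auto
  qed
  then show ?thesis
    unfolding coset_union_def by fastforce
qed

text \<open>Modulo \<open>K\<close> every \<open>a\<close> is a power of \<open>x\<close>, so the
  coset of a signed sum is determined by the exponents alone.\<close>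

lemma finprod_coset_union:
  assumes K: "subgroup K G" and x: "x \<in> carrier G"
    and A: "finite A" "\<And>a. a \<in> A \<Longrightarrow> k a \<in> K" "\<And>a. a \<in> A \<Longrightarrow> a = x [^] (t a) \<otimes> k a"
  shows "\<exists>k'\<in>K. finprod G (\<lambda>a. a [^] (l a :: int)) A = x [^] (\<Sum>a\<in>A. l a * t a) \<otimes> k'"
  using A
proof (induction A rule: finite_induct)
  case empty
  interpret K: subgroup K G by fact
  show ?case by (intro bexI[of _ \<one>]) auto
next
  case (insert a A)
  interpret K: subgroup K G by fact
  from insert obtain k' where k': "k' \<in> K"
    "finprod G (\<lambda>a. a [^] l a) A = x [^] (\<Sum>a\<in>A. l a * t a) \<otimes> k'"
    by (metis insertCI)
  have carr: "b \<in> carrier G" if "b \<in> insert a A" for b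
    using insert.prems[of b] that x by (metis K.mem_carrier int_pow_closed m_closed)
  have ka: "k a \<in> K" using insert.prems by simp
  have kl: "k a [^] l a \<in> K" using subgroup_int_pow_closed[OF K ka] .
  have "a [^] l a = (x [^] t a \<otimes> k a) [^] l a"
    using insert.prems(2)[of a] by simp
  also have "\<dots> = x [^] (l a * t a) \<otimes> k a [^] l a"
    using x ka by (simp add: int_pow_distrib int_pow_pow K.mem_carrier mult.commute)
  finally have a: "a [^] l a = x [^] (l a * t a) \<otimes> k a [^] l a" .
  have "finprod G (\<lambda>a. a [^] l a) (insert a A) = a [^] l a \<otimes> finprod G (\<lambda>a. a [^] l a) A"
    using insert.hyps carr by (intro finprod_insert) auto
  also have "\<dots> = x [^] (\<Sum>a\<in>insert a A. l a * t a) \<otimes> (k a [^] l a \<otimes> k')"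
    using x k'(1) kl
    by (simp only: a k'(2) sum.insert[OF insert.hyps] int_pow_mult K.mem_carrier m_ac m_closed
        int_pow_closed)
  finally show ?case
    using kl k'(1) by blast
qed

text \<open>The hypothesis on \<open>T\<close> reduces the inclusion to a statement about integers.
  It serves both for a progression and, trivially, for \<open>T = UNIV\<close>.\<close>

lemma signed_sumset_subset_coset_union:
  assumes K: "subgroup K G" and x: "x \<in> carrier G"
    and A: "finite A" "A \<subseteq> coset_union G x K S"
    and T: "\<And>t l. \<lbrakk>\<And>a. a \<in> A \<Longrightarrow> t a \<in> S; (\<Sum>a\<in>A. \<bar>l a\<bar>) = int h\<rbrakk>
              \<Longrightarrow> (\<Sum>a\<in>A. l a * t a) \<in> T"
  shows "signed_sumset G h A \<subseteq> coset_union G x K T"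
proof -
  have "\<forall>a\<in>A. \<exists>p. fst p \<in> S \<and> snd p \<in> K \<and> a = x [^] (fst p) \<otimes> snd p"
    using A(2) unfolding coset_union_def by fastforce
  then obtain p where p: "\<forall>a\<in>A. fst (p a) \<in> S \<and> snd (p a) \<in> K \<and> a = x [^] fst (p a) \<otimes> snd (p a)"
    by metis
  show ?thesis
  proof
    fix y assume "y \<in> signed_sumset G h A"
    then obtain l where l: "(\<Sum>a\<in>A. \<bar>l a\<bar>) = int h" and y: "y = finprod G (\<lambda>a. a [^] l a) A"
      by (auto simp: signed_sumset_def)
    have "\<exists>k'\<in>K. y = x [^] (\<Sum>a\<in>A. l a * fst (p a)) \<otimes> k'"
      unfolding y using p by (intro finprod_coset_union[OF K x A(1), of "\<lambda>a. snd (p a)"]) auto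
    moreover have "(\<Sum>a\<in>A. l a * fst (p a)) \<in> T"
      using p l by (intro T) auto
    ultimately show "y \<in> coset_union G x K T"
      by (auto simp: coset_union_def)
  qed
qed

text \<open>By \<open>xK\<close>, \<open>N\<close> is the order of \<open>x\<close> modulo
  \<open>K\<close>. With \<open>d = card K\<close> and \<open>c\<close> the ceiling of
  \<open>m/d\<close>, the bound is the value of \<open>f_bound d m h\<close>.\<close>

lemma exists_small_signed_sumset:
  assumes fin: "finite (carrier G)" and K: "subgroup K G" and x: "x \<in> carrier G"
    and xK: "\<And>j :: int. x [^] j \<in> K \<longleftrightarrow> int N dvd j"
    and c: "c \<ge> 1" "c \<le> N" "m \<le> c * card K" and h: "h \<ge> 2"
  shows "\<exists>A \<subseteq> carrier G. card A = m \<and> card (signed_sumset G h A) \<le> (h * (c - 1) + 1) * card K"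
proof -
  have finK: "finite K"
    using fin K finite_subset subgroup.subset by blast
  have inj: "inj_on (\<lambda>j. 2 * j + b) X" for b :: int and X
    by (auto simp: inj_on_def)
  show ?thesis
  proof (cases "2 * (c - 1) < N")
    case True
    \<comment> \<open>In step 2, \<open>S\<close> runs from \<open>-(c-1)\<close> to
      \<open>c-1\<close> with \<open>c\<close> terms, and \<open>T\<close> from
      \<open>-h(c-1)\<close> to \<open>h(c-1)\<close> with \<open>h(c-1)+1\<close> terms.\<close>
    define S where "S = (\<lambda>j. 2 * j + - (int c - 1)) ` {0..<int c}"
    define T where "T = (\<lambda>j. 2 * j + - (int h * (int c - 1))) ` {0..<int h * (int c - 1) + 1}"
    have "card (coset_union G x K S) = card S * card K"
    proof (rule card_coset_union[OF K x])
      fix i j assume "i \<in> S" "j \<in> S" and "x [^] (i - j) \<in> K"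
      \<comment> \<open>Two elements of \<open>S\<close> differ by at most
        \<open>2(c-1) < N\<close>, so a difference divisible by \<open>N\<close> is 0.\<close>
      then have "\<bar>i - j\<bar> < int N" "int N dvd i - j"
        using True c xK by (auto simp: S_def)
      then show "i = j"
        using dvd_imp_le_int[of "i - j" "int N"] by force
    qed
    also have "card S = c"
      unfolding S_def by (subst card_image[OF inj]) auto
    finally obtain A where A: "A \<subseteq> coset_union G x K S" "card A = m"
      using c(3) by (metis obtain_subset_with_card_n)
    have AG: "A \<subseteq> carrier G"
      using A coset_union_subset_carrier[OF K x] by blast
    have finA: "finite A"
      using AG fin finite_subset by blast
    have "signed_sumset G h A \<subseteq> coset_union G x K T"
    proof (rule signed_sumset_subset_coset_union[OF K x finA A(1)])
      fix t l :: "'a \<Rightarrow> int"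
      assume t: "\<And>a. a \<in> A \<Longrightarrow> t a \<in> S" and l: "(\<Sum>a\<in>A. \<bar>l a\<bar>) = int h"
      define s where "s = (\<Sum>a\<in>A. l a * t a)"
      have "\<bar>s\<bar> \<le> (\<Sum>a\<in>A. \<bar>l a * t a\<bar>)"
        unfolding s_def by (rule sum_abs)
      also have "\<dots> \<le> (\<Sum>a\<in>A. \<bar>l a\<bar> * (int c - 1))"
      proof (rule sum_mono)
        fix a assume "a \<in> A"
        then have "\<bar>t a\<bar> \<le> int c - 1"
          using t[of a] by (auto simp: S_def)
        then show "\<bar>l a * t a\<bar> \<le> \<bar>l a\<bar> * (int c - 1)"
          by (simp add: abs_mult mult_left_mono)
      qed
      also have "\<dots> = int h * (int c - 1)"
        using l by (simp flip: sum_distrib_right)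
      finally have bound: "\<bar>s\<bar> \<le> int h * (int c - 1)" .
      \<comment> \<open>Every summand is even: \<open>t a\<close> has the parity of
        \<open>c - 1\<close>, and \<open>l a\<close> that of its absolute value.\<close>
      have "s + int h * (int c - 1) = (\<Sum>a\<in>A. l a * t a + \<bar>l a\<bar> * (int c - 1))"
        by (simp add: s_def sum.distrib flip: l sum_distrib_right)
      moreover have "even \<dots>"
      proof (rule dvd_sum)
        fix a assume "a \<in> A"
        then show "even (l a * t a + \<bar>l a\<bar> * (int c - 1))"
          using t[of a] by (auto simp: S_def)
      qed
      ultimately obtain q where "s + int h * (int c - 1) = 2 * q"
        by (metis evenE)
      with bound show "(\<Sum>a\<in>A. l a * t a) \<in> T"
        unfolding s_def[symmetric] T_def by (intro image_eqI[where x = q]) auto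
    qed
    then have "card (signed_sumset G h A) \<le> card (coset_union G x K T)"
      using finK by (intro card_mono finite_coset_union) (auto simp: T_def)
    also have "\<dots> \<le> card T * card K"
      using finK by (intro card_coset_union_le) (auto simp: T_def)
    also have "card T = h * (c - 1) + 1"
      unfolding T_def using c(1)
      by (subst card_image[OF inj]) (simp add: nat_add_distrib nat_mult_distrib nat_diff_distrib)
    finally show ?thesis
      using A AG by blast
  next
    case False
    have N: "N \<le> h * (c - 1) + 1"
      using False mult_le_mono1[OF h, of "c - 1"] by linarith
    have Npos: "int N > 0" using c by simp
    have xN: "x [^] int N \<in> K" by (simp add: xK)
    have "card (coset_union G x K {0..<int N}) = card {0..<int N} * card K"
    proof (rule card_coset_union[OF K x])
      fix i j assume "i \<in> {0..<int N}" "j \<in> {0..<int N}" and "x [^] (i - j) \<in> K"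
      then have "\<bar>i - j\<bar> < int N" "int N dvd i - j"
        using xK by auto
      then show "i = j"
        using dvd_imp_le_int[of "i - j" "int N"] by force
    qed
    then have "card (coset_union G x K {0..<int N}) \<ge> m"
      using le_trans[OF c(3) mult_le_mono1[OF c(2)]] by simp
    then obtain A where A: "A \<subseteq> coset_union G x K {0..<int N}" "card A = m"
      by (metis obtain_subset_with_card_n)
    have AG: "A \<subseteq> carrier G"
      using A coset_union_subset_carrier[OF K x] by blast
    have finA: "finite A"
      using AG fin finite_subset by blast
    \<comment> \<open>With all integers allowed as exponents nothing is to be checked about the
      sums; reduction modulo \<open>N\<close> then returns to \<open>N\<close> cosets.\<close>
    have "signed_sumset G h A \<subseteq> coset_union G x K {0..<int N}"
      using signed_sumset_subset_coset_union[OF K x finA A(1), of h UNIV]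
      by (simp add: coset_union_UNIV[OF K x Npos xN])
    then have "card (signed_sumset G h A) \<le> card (coset_union G x K {0..<int N})"
      using finK by (intro card_mono finite_coset_union) auto
    also have "\<dots> \<le> N * card K"
      using card_coset_union_le[of "{0..<int N}" K] finK by simp
    also have "\<dots> \<le> (h * (c - 1) + 1) * card K"
      using N by (rule mult_le_mono1)
    finally show ?thesis
      using A AG by blast
  qed
qed

end

section \<open>From the type of the group to a subgroup and a generator\<close>

lemma rho_pm_le:
  assumes "finite (carrier G)" "A \<subseteq> carrier G" "card A = m"
  shows "rho_pm G m h \<le> card (signed_sumset G h A)"
proof -
  have "{card (signed_sumset G h A) | A. A \<subseteq> carrier G \<and> card A = m}
          \<subseteq> (\<lambda>A. card (signed_sumset G h A)) ` Pow (carrier G)"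
    by auto
  then have "finite {card (signed_sumset G h A) | A. A \<subseteq> carrier G \<and> card A = m}"
    using assms(1) by (meson finite_Pow_iff finite_imageI finite_subset)
  then show ?thesis
    unfolding rho_pm_def using assms by (intro Min_le) auto
qed

lemma order_has_type:
  assumes "has_type G r ns"
  shows "order G = (\<Prod>i=1..r. ns i)"
proof -
  \<comment> \<open>This includes \<open>n = 0\<close>, where the carrier is all of the integers and
    \<open>card\<close> of this infinite set is 0.\<close>
  have "card (carrier (integer_mod_group n)) = n" for n
    by (simp add: carrier_integer_mod_group infinite_UNIV_int)
  then have "card (\<Pi>\<^sub>E i\<in>{1..r}. carrier (integer_mod_group (ns i))) = (\<Prod>i=1..r. ns i)"
    by (simp add: card_PiE)
  moreover obtain f where "f \<in> iso G (product_group {1..r} (\<lambda>i. integer_mod_group (ns i)))"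
    using assms by (auto simp: has_type_def is_iso_def)
  ultimately show ?thesis
    using bij_betw_same_card[of f] by (fastforce simp: iso_def order_def)
qed

text \<open>Since \<open>N\<close> divides \<open>n\<close>, reduction modulo \<open>n\<close>
  preserves divisibility by \<open>N\<close>.\<close>

lemma subgroup_multiples_integer_mod_group:
  assumes "N dvd n"
  shows "subgroup {y \<in> carrier (integer_mod_group n). int N dvd y} (integer_mod_group n)"
proof -
  have N: "int N dvd int n" using assms by simp
  show ?thesis
  proof
    fix y z assume "y \<in> {y \<in> carrier (integer_mod_group n). int N dvd y}"
      "z \<in> {y \<in> carrier (integer_mod_group n). int N dvd y}"
    then show "y \<otimes>\<^bsub>integer_mod_group n\<^esub> z \<in> {y \<in> carrier (integer_mod_group n). int N dvd y}"
      using N group.is_monoid[OF group_integer_mod_group, THEN monoid.m_closed, of y n z]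
      by (auto simp: dvd_mod_iff)
  next
    fix y assume "y \<in> {y \<in> carrier (integer_mod_group n). int N dvd y}"
    then show "inv\<^bsub>integer_mod_group n\<^esub> y \<in> {y \<in> carrier (integer_mod_group n). int N dvd y}"
      using N group.inv_closed[OF group_integer_mod_group, of y n]
      by (auto simp: dvd_mod_iff)
  qed auto
qed

lemma card_multiples_integer_mod_group:
  assumes "n > 0" "n = N * d"
  shows "card {y \<in> carrier (integer_mod_group n). int N dvd y} = d"
proof -
  have "{y \<in> carrier (integer_mod_group n). int N dvd y} = (\<lambda>j. int N * j) ` {0..<int d}"
    using assms by (fastforce simp: carrier_integer_mod_group zero_le_mult_iff)
  moreover have "inj_on (\<lambda>j. int N * j) {0..<int d}"
    using assms by (auto simp: inj_on_def)
  ultimately show ?thesis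
    by (simp add: card_image)
qed

lemma exists_subgroup_and_generator:
  assumes G: "comm_group G" "finite (carrier G)" and type: "has_type G r ns"
    and ds: "\<And>i. i \<in> {1..r} \<Longrightarrow> ds i \<in> pos_divisors (ns i)"
  shows "\<exists>K x. subgroup K G \<and> card K = (\<Prod>i=1..r. ds i) \<and> x \<in> carrier G \<and>
           (\<forall>j :: int. x [^]\<^bsub>G\<^esub> j \<in> K \<longleftrightarrow> int (ns r div ds r) dvd j)"
proof -
  interpret G: comm_group G by fact
  let ?Z = "\<lambda>i. integer_mod_group (ns i)"
  define P where "P = product_group {1..r} ?Z"
  interpret P: group P by (simp add: P_def)
  have r: "r \<ge> 1" using type by (simp add: has_type_def)
  \<comment> \<open>\<open>has_type\<close> alone permits later entries to be 0, as everything
    divides 0; finiteness of \<open>G\<close> excludes this.\<close>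
  have "(\<Prod>i=1..r. ns i) > 0"
    using G order_has_type[OF type] G.order_gt_0_iff_finite by simp
  then have ns: "ns i > 0" if "i \<in> {1..r}" for i
    using that by (simp add: prod_pos_nat_iff)
  obtain f where f: "f \<in> iso P G"
    using G.iso_sym type by (auto simp: has_type_def is_iso_def P_def)
  interpret f: group_hom P G f
    using f by unfold_locales (simp add: iso_def)
  have inj: "inj_on f (carrier P)"
    using f by (simp add: iso_def bij_betw_def)
  define H where "H i = {y \<in> carrier (?Z i). int (ns i div ds i) dvd y}" for i
  define K where "K = PiE {1..r} H"
  have K: "subgroup K P"
    using ds unfolding K_def P_def H_def
    by (subst PiE_subgroup_product_group)
      (auto simp: pos_divisors_def div_dvd_iff_mult intro!: subgroup_multiples_integer_mod_group)
  have "card (H i) = ds i" if "i \<in> {1..r}" for i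
    unfolding H_def using ds ns that
    by (intro card_multiples_integer_mod_group) (auto simp: pos_divisors_def)
  then have cardK: "card K = (\<Prod>i=1..r. ds i)"
    by (simp add: K_def card_PiE)
  \<comment> \<open>The generator of the last factor. Reducing 1 modulo \<open>ns r\<close> puts the
    entry into the carrier from \<open>ns r > 0\<close> alone.\<close>
  define e where "e = (\<lambda>i\<in>{1..r}. if i = r then 1 mod int (ns r) else 0)"
  have e: "e \<in> carrier P"
    using ns r by (auto simp: P_def e_def carrier_integer_mod_group)
  \<comment> \<open>Projection to a coordinate is a homomorphism, so powers are computed
    coordinatewise.\<close>
  have pow: "(e [^]\<^bsub>P\<^esub> j) i = (j * e i) mod int (ns i)" if "i \<in> {1..r}" for i and j :: int
  proof -
    have "(\<lambda>g. g i) \<in> hom P (?Z i)"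
      using that by (auto simp: hom_def P_def)
    from hom_int_pow[OF this e, of j] show ?thesis
      by (simp add: int_pow_integer_mod_group)
  qed
  have e_nth: "e i = (if i = r then 1 mod int (ns r) else 0)" if "i \<in> {1..r}" for i
    using that by (simp add: e_def)
  have eK: "e [^]\<^bsub>P\<^esub> j \<in> K \<longleftrightarrow> int (ns r div ds r) dvd j" for j :: int
  proof -
    have "e [^]\<^bsub>P\<^esub> j \<in> carrier P"
      using e by blast
    then have "e [^]\<^bsub>P\<^esub> j \<in> K \<longleftrightarrow> (\<forall>i\<in>{1..r}. int (ns i div ds i) dvd (e [^]\<^bsub>P\<^esub> j) i)"
      by (auto simp: K_def H_def P_def PiE_iff)
    \<comment> \<open>The other coordinates of the power are 0 and impose no condition.\<close>
    also have "\<dots> \<longleftrightarrow> int (ns r div ds r) dvd (e [^]\<^bsub>P\<^esub> j) r"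
      using r by (auto simp: pow e_nth)
    also have "(e [^]\<^bsub>P\<^esub> j) r = j mod int (ns r)"
      using r by (simp add: pow e_nth mod_mult_right_eq)
    also have "int (ns r div ds r) dvd j mod int (ns r) \<longleftrightarrow> int (ns r div ds r) dvd j"
      using ds[of r] r by (intro dvd_mod_iff) (auto simp: pos_divisors_def)
    finally show ?thesis .
  qed
  have KP: "K \<subseteq> carrier P"
    using K by (rule subgroup.subset)
  have "f e [^]\<^bsub>G\<^esub> j \<in> f ` K \<longleftrightarrow> int (ns r div ds r) dvd j" for j :: int
    using inj_on_image_mem_iff[OF inj _ KP, of "e [^]\<^bsub>P\<^esub> j"] e eK
    by (simp add: f.hom_int_pow)
  moreover have "card (f ` K) = (\<Prod>i=1..r. ds i)"
    using cardK card_image[OF inj_on_subset[OF inj KP]] by simp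
  ultimately show ?thesis
    using f.subgroup_img_is_subgroup[OF K] f.hom_closed[OF e]
    by (intro exI[of _ "f ` K"] exI[of _ "f e"]) simp
qed

section \<open>The bound for each divisor and the minimum over all of them\<close>

theorem theorem5:
  fixes G :: "('a, 'b) monoid_scheme" and r m h :: nat and ns :: "nat \<Rightarrow> nat"
  assumes "comm_group G" and "finite (carrier G)"
    and "has_type G r ns"
    and "m \<ge> 1" and "m \<le> order G"
    and "h \<ge> 2"
  shows "int (rho_pm G m h) \<le> Min {f_bound d m h | d. d \<in> type_divisors G r ns m}"
proof -
  interpret G: comm_group G by fact
  have order: "order G = (\<Prod>i=1..r. ns i)" "order G > 0"
    using assms order_has_type G.order_gt_0_iff_finite by auto
  then have ns: "ns i > 0" if "i \<in> {1..r}" for i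
    using that by (simp add: prod_pos_nat_iff)
  have r: "r \<in> {1..r}"
    using assms(3) by (simp add: has_type_def)
  have "type_divisors G r ns m \<subseteq> {d. d dvd order G}"
    by (auto simp: type_divisors_def pos_divisors_def)
  then have fin: "finite (type_divisors G r ns m)"
    using order(2) finite_divisors_nat finite_subset by blast
  \<comment> \<open>The minimum is over a nonempty set: for \<open>ds = ns\<close> the required
    inequality follows from \<open>m \<le> order G\<close>.\<close>
  have "order G \<in> type_divisors G r ns m"
    using order ns assms(5) by (auto simp: type_divisors_def pos_divisors_def intro!: exI[of _ ns])
  moreover have "int (rho_pm G m h) \<le> f_bound d m h" if "d \<in> type_divisors G r ns m" for d
  proof -
    from that obtain ds where ds: "\<And>i. i \<in> {1..r} \<Longrightarrow> ds i \<in> pos_divisors (ns i)"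
      and d: "d = (\<Prod>i=1..r. ds i)" "d > 0" and dm: "ds r * m \<le> d * ns r"
      unfolding type_divisors_def pos_divisors_def by blast
    obtain K x where K: "subgroup K G" "card K = d" and x: "x \<in> carrier G"
      and xK: "\<And>j :: int. x [^]\<^bsub>G\<^esub> j \<in> K \<longleftrightarrow> int (ns r div ds r) dvd j"
      using exists_subgroup_and_generator[OF assms(1-3) ds] d(1) by metis
    define c where "c = nat \<lceil>real m / real d\<rceil>"
    \<comment> \<open>The quotient exceeds -1, so its ceiling is nonnegative and \<open>nat\<close>
      loses nothing.\<close>
    have c: "int c = \<lceil>real m / real d\<rceil>"
      using less_le_trans[of "-1" 0 "real m / real d"] by (simp add: c_def)
    have "0 < int c"
      unfolding c using assms(4) d(2) by simp
    then have c1: "c \<ge> 1"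
      by simp
    have "real m / real d \<le> real c"
      unfolding c_def by (rule real_nat_ceiling_ge)
    then have "real m \<le> real c * real d"
      using d(2) by (simp add: pos_divide_le_eq)
    then have m: "m \<le> c * card K"
      by (simp add: K(2) flip: of_nat_mult)
    have "ds r dvd ns r" "ds r > 0"
      using ds[OF r] by (auto simp: pos_divisors_def)
    \<comment> \<open>Cancel \<open>ds r\<close> in \<open>dm\<close> after writing
      \<open>ns r\<close> as a multiple of it. As \<open>ns r div ds r\<close> is an integer above
      \<open>m/d\<close>, it also bounds the ceiling \<open>c\<close>.\<close>
    then have "m \<le> d * (ns r div ds r)"
      using dm by (auto elim!: dvdE simp: algebra_simps)
    then have "real m / real d \<le> real (ns r div ds r)"
      using d(2) by (simp add: field_simps flip: of_nat_mult)
    then have cN: "c \<le> ns r div ds r"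
      by (simp add: c_def ceiling_le_iff nat_le_iff)
    obtain A where A: "A \<subseteq> carrier G" "card A = m"
      "card (signed_sumset G h A) \<le> (h * (c - 1) + 1) * card K"
      using G.exists_small_signed_sumset[OF assms(2) K(1) x xK c1 cN m assms(6)] by blast
    have "rho_pm G m h \<le> (h * (c - 1) + 1) * d"
      using rho_pm_le[OF assms(2) A(1,2), of h] A(3) K(2) by simp
    then have "int (rho_pm G m h) \<le> int ((h * (c - 1) + 1) * d)"
      by (simp only: of_nat_le_iff)
    \<comment> \<open>Since \<open>c \<ge> 1\<close>, the natural subtraction \<open>c - 1\<close>
      agrees with the integer one.\<close>
    also have "\<dots> = f_bound d m h"
      using c1 by (simp add: f_bound_def of_nat_diff right_diff_distrib distrib_right flip: c)
    finally show ?thesis .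
  qed
  ultimately show ?thesis
    using fin by (subst Min_ge_iff) auto
qed

end
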